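(* Let $R$ be a commutative Noetherian ring with identity, $M$ a finitely generated unitary $R$-module, $N$ a proper submodule of $M$, and $\mathfrak{a}=\mathrm{Ann}(M/N)$. If every prime ideal in $\mathrm{Ass}(M/N)$ is isolated, then $\mathcal{P}_R(\mathfrak{a})=\mathcal{P}_M(N)$.
   Context: Throughout, $R$ is a commutative Noetherian ring with identity and $M$ is a finitely generated unitary $R$-module; ideals of $R$ are regarded as submodules of the $R$-module $R$. The symbol $\subset$ denotes proper inclusion. For submodules $N,K$ of $M$, $(N:K)=\{a\in R \mid aK\subseteq N\}$; for an ideal $I$ of $R$, $(N:I)=\{x\in M\mid Ix\subseteq N\}$. $\mathrm{Ass}(M/N)$ is the set of associated primes of $M/N$, and $\mathrm{Ann}(M/N)=(N:M)$. A prime in $\mathrm{Ass}(M/N)$ is isolated if it is a minimal element of $\mathrm{Ass}(M/N)$ under inclusion. Prime submodule: a proper submodule $N$ of $M$ is a $\mathfrak{p}$-prime submodule of $M$ if $(N:M)=\mathfrak{p}$ and for all $a\in R$, $x\in M$, $ax\in N$ implies $a\in (N:M)$ or $x\in N$ (then $\mathfrak p$ is a prime ideal). A submodule $K\supset N$ of $M$ is a $\mathfrak{p}$-prime extension of $N$, written $N\overset{\mathfrak p}{\subset}K$, if $N$ is a $\mathfrak{p}$-prime submodule of $K$. If $\mathfrak{p}$ is a maximal element (under inclusion) of $\mathrm{Ass}(M/N)$, then $(N:\mathfrak{p})$ is the unique maximal $\mathfrak{p}$-prime extension of $N$ in $M$, and it is called the regular $\mathfrak{p}$-prime extension of $N$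 in $M$. RPE filtration: a filtration $N=M_0\overset{\mathfrak{p}_1}{\subset}M_1\subset\cdots\overset{\mathfrak{p}_n}{\subset}M_n=M$ is a regular prime extension (RPE) filtration of $M$ over $N$ if each $M_i$ is a regular $\mathfrak{p}_i$-prime extension of $M_{i-1}$ in $M$, $1\le i\le n$. Factorization: for a proper submodule $N$ of $M$, RPE filtrations of $M$ over $N$ exist, and it is known that the number of occurrences of each prime ideal is the same in all of them. The generalized prime ideal factorization of $N$ in $M$ is the formal product $\mathcal{P}_M(N)=\mathfrak{p}_1\cdots\mathfrak{p}_n$ of the primes occurring in any RPE filtration of $M$ over $N$, i.e. the multiset of these primes; equality of two such factorizations means equality as multisets of prime ideals (not merely equality of the product ideals). $\mathcal{P}_R(\mathfrak{a})$ is the factorization of the proper ideal $\mathfrak{a}$ regarded as a submodule of the $R$-module $R$. *)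

theory Defs
  imports "HOL-Library.Multiset" "HOL-Algebra.Ring_Divisibility" "HOL-Algebra.Module"
begin

text \<open>The record type of modules extends that of rings, so it carries ring operations \<^term>\<open>monoid.mult\<close>
  and \<^term>\<open>one\<close> that play no role in the module axioms; for quotients they are left unspecified.\<close>

definition self_module :: "('a, 'c) ring_scheme \<Rightarrow> ('a, 'a) module"
  where "self_module R =
    \<lparr>carrier = carrier R, monoid.mult = monoid.mult R, one = one R, zero = zero R, add = add R, smult = monoid.mult R\<rparr>"

definition quotient_module :: "('a, 'b, 'd) module_scheme \<Rightarrow> 'b set \<Rightarrow> ('a, 'b set) module"
  where "quotient_module M N =
    \<lparr>carrier = a_rcosets\<^bsub>M\<^esub> N, monoid.mult = undefined, one = undefined, zero = N, add = set_add M,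
     smult = (\<lambda>a X. \<Union>x\<in>X. N +>\<^bsub>M\<^esub> (a \<odot>\<^bsub>M\<^esub> x))\<rparr>"

definition generated_submodule ::
    "('a, 'c) ring_scheme \<Rightarrow> ('a, 'b, 'd) module_scheme \<Rightarrow> 'b set \<Rightarrow> 'b set"
  where "generated_submodule R M S = \<Inter>{H. submodule H R M \<and> S \<subseteq> H}"

definition finitely_generated_module ::
    "('a, 'c) ring_scheme \<Rightarrow> ('a, 'b, 'd) module_scheme \<Rightarrow> bool"
  where "finitely_generated_module R M \<longleftrightarrow>
    (\<exists>S. finite S \<and> S \<subseteq> carrier M \<and> generated_submodule R M S = carrier M)"

text \<open>The two residuals: \<open>(N : K)\<close>, an ideal of \<open>R\<close>, and \<open>(N : I)\<close>, a submodule of \<open>M\<close>.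
  In particular \<open>Ann(M/N) = (N : M)\<close>.\<close>

definition residual_ideal ::
    "('a, 'c) ring_scheme \<Rightarrow> ('a, 'b, 'd) module_scheme \<Rightarrow> 'b set \<Rightarrow> 'b set \<Rightarrow> 'a set"
  where "residual_ideal R M N K = {a \<in> carrier R. \<forall>x\<in>K. a \<odot>\<^bsub>M\<^esub> x \<in> N}"

definition residual_submodule :: "('a, 'b, 'd) module_scheme \<Rightarrow> 'b set \<Rightarrow> 'a set \<Rightarrow> 'b set"
  where "residual_submodule M N I = {x \<in> carrier M. \<forall>a\<in>I. a \<odot>\<^bsub>M\<^esub> x \<in> N}"

definition Ass :: "('a, 'c) ring_scheme \<Rightarrow> ('a, 'b, 'd) module_scheme \<Rightarrow> 'a set set"
  where "Ass R M =
    {p. primeideal p R \<and> (\<exists>x\<in>carrier M. p = {a \<in> carrier R. a \<odot>\<^bsub>M\<^esub> x = \<zero>\<^bsub>M\<^esub>})}"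

definition isolated_prime ::
    "('a, 'c) ring_scheme \<Rightarrow> ('a, 'b, 'd) module_scheme \<Rightarrow> 'b set \<Rightarrow> 'a set \<Rightarrow> bool"
  where "isolated_prime R M N p \<longleftrightarrow>
    p \<in> Ass R (quotient_module M N) \<and> (\<forall>q\<in>Ass R (quotient_module M N). q \<subseteq> p \<longrightarrow> q = p)"

definition maximal_ass_prime ::
    "('a, 'c) ring_scheme \<Rightarrow> ('a, 'b, 'd) module_scheme \<Rightarrow> 'b set \<Rightarrow> 'a set \<Rightarrow> bool"
  where "maximal_ass_prime R M N p \<longleftrightarrow>
    p \<in> Ass R (quotient_module M N) \<and> (\<forall>q\<in>Ass R (quotient_module M N). p \<subseteq> q \<longrightarrow> q = p)"

definition prime_submodule ::
    "('a, 'c) ring_scheme \<Rightarrow> ('a, 'b, 'd) module_scheme \<Rightarrow> 'a set \<Rightarrow> 'b set \<Rightarrow> bool"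
  where "prime_submodule R M p N \<longleftrightarrow>
    submodule N R M \<and> N \<noteq> carrier M \<and> residual_ideal R M N (carrier M) = p \<and>
    (\<forall>a\<in>carrier R. \<forall>x\<in>carrier M.
      a \<odot>\<^bsub>M\<^esub> x \<in> N \<longrightarrow> a \<in> residual_ideal R M N (carrier M) \<or> x \<in> N)"

definition prime_extension ::
    "('a, 'c) ring_scheme \<Rightarrow> ('a, 'b, 'd) module_scheme \<Rightarrow> 'a set \<Rightarrow> 'b set \<Rightarrow> 'b set \<Rightarrow> bool"
  where "prime_extension R M p N K \<longleftrightarrow>
    submodule K R M \<and> N \<subset> K \<and> prime_submodule R (M\<lparr>carrier := K\<rparr>) p N"

definition regular_prime_extension ::
    "('a, 'c) ring_scheme \<Rightarrow> ('a, 'b, 'd) module_scheme \<Rightarrow> 'a set \<Rightarrow> 'b set \<Rightarrow> 'b set \<Rightarrow> bool"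
  where "regular_prime_extension R M p N K \<longleftrightarrow>
    prime_extension R M p N K \<and> maximal_ass_prime R M N p \<and> K = residual_submodule M N p"

text \<open>The list \<open>ps\<close> is \<open>[p\<^sub>1, \<dots>, p\<^sub>n]\<close>, so \<open>ps ! i\<close> labels the step from \<open>F i\<close> to \<open>F (Suc i)\<close>;
  the values of \<open>F\<close> beyond \<open>n\<close> are irrelevant.\<close>

definition rpe_filtration ::
    "('a, 'c) ring_scheme \<Rightarrow> ('a, 'b, 'd) module_scheme \<Rightarrow> 'b set \<Rightarrow> (nat \<Rightarrow> 'b set) \<Rightarrow> 'a set list \<Rightarrow> bool"
  where "rpe_filtration R M N F ps \<longleftrightarrow>
    F 0 = N \<and> F (length ps) = carrier M \<and>
    (\<forall>i<length ps. regular_prime_extension R M (ps ! i) (F i) (F (Suc i)))"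

text \<open>The formal product of primes is the multiset of its factors. The description is meaningful
  for a proper submodule \<open>N\<close> of a finitely generated module over a Noetherian ring, because then
  RPE filtrations exist and all yield the same multiset.\<close>

definition prime_ideal_factorization ::
    "('a, 'c) ring_scheme \<Rightarrow> ('a, 'b, 'd) module_scheme \<Rightarrow> 'b set \<Rightarrow> 'a set multiset"
  where "prime_ideal_factorization R M N =
    (THE P. \<exists>F ps. rpe_filtration R M N F ps \<and> P = mset ps)"

lemma module_self_module:
  assumes "cring R" shows "module R (self_module R)"
proof -
  interpret cring R by fact
  show ?thesis
  proof (rule moduleI)
    show "abelian_group (self_module R)"
      by (rule abelian_groupI)
        (auto simp: self_module_def a_ac intro: bexI[of _ "\<ominus>\<^bsub>R\<^esub> _"] l_neg)
  qed (auto simp: self_module_def l_distr r_distr m_assoc is_cring)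
qed

lemma submodule_self_module_iff:
  assumes "cring R" shows "submodule I R (self_module R) \<longleftrightarrow> ideal I R"
proof -
  interpret cring R by fact
  have inv: "m_inv (add_monoid (self_module R)) = m_inv (add_monoid R)"
    by (rule ext) (simp add: m_inv_def self_module_def)
  have grp: "subgroup I (add_monoid (self_module R)) \<longleftrightarrow> subgroup I (add_monoid R)"
    unfolding subgroup_def inv by (simp add: self_module_def)
  show ?thesis
  proof
    assume sub: "submodule I R (self_module R)"
    then have sg: "subgroup I (add_monoid R)"
      by (simp add: submodule_def grp)
    have l: "\<And>a x. a \<in> I \<Longrightarrow> x \<in> carrier R \<Longrightarrow> x \<otimes>\<^bsub>R\<^esub> a \<in> I"
      using submodule.smult_closed[OF sub] by (simp add: self_module_def)
    moreover have "a \<otimes>\<^bsub>R\<^esub> x \<in> I" if "a \<in> I" "x \<in> carrier R" for a x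
      using l[OF that] that m_comm[of a x] subgroup.subset[OF sg] by auto
    ultimately show "ideal I R"
      by (rule idealI[OF ring_axioms sg])
  next
    assume "ideal I R"
    then interpret I: ideal I R .
    show "submodule I R (self_module R)"
      using I.a_subgroup I.I_l_closed
      by (simp add: submodule_def submodule_axioms_def grp) (simp add: self_module_def)
  qed
qed

lemma smult_quotient_module:
  assumes "module R M" "submodule N R M" "a \<in> carrier R" "x \<in> carrier M"
  shows "a \<odot>\<^bsub>quotient_module M N\<^esub> (N +>\<^bsub>M\<^esub> x) = N +>\<^bsub>M\<^esub> (a \<odot>\<^bsub>M\<^esub> x)"
proof -
  interpret module R M by fact
  interpret N: submodule N R M by fact
  have sub: "N \<subseteq> carrier M" using submoduleE(1)[OF assms(2)] .
  have sg: "subgroup N (add_monoid M)" by (rule N.subgroup_axioms)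
  have "N +>\<^bsub>M\<^esub> (a \<odot>\<^bsub>M\<^esub> y) = N +>\<^bsub>M\<^esub> (a \<odot>\<^bsub>M\<^esub> x)" if y: "y \<in> N +>\<^bsub>M\<^esub> x" for y
  proof -
    obtain h where h: "h \<in> N" "y = h \<oplus>\<^bsub>M\<^esub> x" using y by (auto simp: a_r_coset_def')
    then have "a \<odot>\<^bsub>M\<^esub> y = a \<odot>\<^bsub>M\<^esub> h \<oplus>\<^bsub>M\<^esub> a \<odot>\<^bsub>M\<^esub> x"
      using assms(3,4) sub by (simp add: smult_r_distr subsetD)
    moreover have "a \<odot>\<^bsub>M\<^esub> h \<in> N" using N.smult_closed[OF assms(3) h(1)] .
    ultimately have "a \<odot>\<^bsub>M\<^esub> y \<in> N +>\<^bsub>M\<^esub> (a \<odot>\<^bsub>M\<^esub> x)" by (auto simp: a_r_coset_def')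
    then show ?thesis
      using M.a_repr_independence'[of "a \<odot>\<^bsub>M\<^esub> y" N "a \<odot>\<^bsub>M\<^esub> x"] sg assms
      by (simp add: a_r_coset_def)
  qed
  note coset = this
  have "x \<in> N +>\<^bsub>M\<^esub> x"
    using M.add.rcos_self[OF _ sg] assms by (simp add: a_r_coset_def)
  then have "(\<Union>y\<in>N +>\<^bsub>M\<^esub> x. N +>\<^bsub>M\<^esub> (a \<odot>\<^bsub>M\<^esub> y)) = N +>\<^bsub>M\<^esub> (a \<odot>\<^bsub>M\<^esub> x)"
    using coset by blast
  then show ?thesis by (simp add: quotient_module_def)
qed

lemma module_quotient_module:
  assumes "module R M" "submodule N R M"
  shows "module R (quotient_module M N)"
proof -
  interpret module R M by fact
  interpret N: submodule N R M by fact
  interpret N: abelian_subgroup N M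
    by (intro abelian_subgroupI3 additive_subgroup.intro N.subgroup_axioms M.abelian_group_axioms)
  let ?Q = "quotient_module M N"
  have carr: "X \<in> carrier ?Q \<longleftrightarrow> (\<exists>x\<in>carrier M. X = N +>\<^bsub>M\<^esub> x)" for X
    by (auto simp: quotient_module_def A_RCOSETS_def')
  have add: "(N +>\<^bsub>M\<^esub> x) \<oplus>\<^bsub>?Q\<^esub> (N +>\<^bsub>M\<^esub> y) = N +>\<^bsub>M\<^esub> (x \<oplus>\<^bsub>M\<^esub> y)"
    if "x \<in> carrier M" "y \<in> carrier M" for x y
    using that by (simp add: quotient_module_def N.a_rcos_sum)
  note sm = smult_quotient_module[OF assms]
  show ?thesis
  proof (rule moduleI)
    have zero: "\<zero>\<^bsub>?Q\<^esub> = N +>\<^bsub>M\<^esub> \<zero>\<^bsub>M\<^esub>"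
      using submoduleE(1)[OF assms(2)] by (simp add: quotient_module_def M.a_coset_add_zero)
    have closed: "N +>\<^bsub>M\<^esub> x \<in> carrier ?Q" if "x \<in> carrier M" for x
      using that carr by blast
    show "abelian_group ?Q"
    proof (rule abelian_groupI)
      fix X assume "X \<in> carrier ?Q"
      then obtain x where x: "x \<in> carrier M" "X = N +>\<^bsub>M\<^esub> x" unfolding carr by blast
      show "\<zero>\<^bsub>?Q\<^esub> \<oplus>\<^bsub>?Q\<^esub> X = X"
        unfolding x(2) zero by (simp add: add x(1))
      have "(N +>\<^bsub>M\<^esub> (\<ominus>\<^bsub>M\<^esub> x)) \<oplus>\<^bsub>?Q\<^esub> X = \<zero>\<^bsub>?Q\<^esub>"
        unfolding x(2) zero by (simp add: add x(1) M.l_neg)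
      then show "\<exists>Y\<in>carrier ?Q. Y \<oplus>\<^bsub>?Q\<^esub> X = \<zero>\<^bsub>?Q\<^esub>"
        using closed[of "\<ominus>\<^bsub>M\<^esub> x"] x(1) by blast
      fix Y assume "Y \<in> carrier ?Q"
      then obtain y where y: "y \<in> carrier M" "Y = N +>\<^bsub>M\<^esub> y" unfolding carr by blast
      show "X \<oplus>\<^bsub>?Q\<^esub> Y \<in> carrier ?Q"
        unfolding x(2) y(2) by (simp add: add x(1) y(1) closed)
      show "X \<oplus>\<^bsub>?Q\<^esub> Y = Y \<oplus>\<^bsub>?Q\<^esub> X"
        unfolding x(2) y(2) by (simp add: add x(1) y(1) M.a_comm)
      fix Z assume "Z \<in> carrier ?Q"
      then obtain z where z: "z \<in> carrier M" "Z = N +>\<^bsub>M\<^esub> z" unfolding carr by blast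
      show "(X \<oplus>\<^bsub>?Q\<^esub> Y) \<oplus>\<^bsub>?Q\<^esub> Z = X \<oplus>\<^bsub>?Q\<^esub> (Y \<oplus>\<^bsub>?Q\<^esub> Z)"
        unfolding x(2) y(2) z(2) by (simp add: add x(1) y(1) z(1) M.a_assoc)
    next
      show "\<zero>\<^bsub>?Q\<^esub> \<in> carrier ?Q"
        unfolding zero by (simp add: closed)
    qed
  next
    fix a X assume a: "a \<in> carrier R" and "X \<in> carrier ?Q"
    then obtain x where x: "x \<in> carrier M" "X = N +>\<^bsub>M\<^esub> x" unfolding carr by blast
    have "a \<odot>\<^bsub>M\<^esub> x \<in> carrier M" using a x(1) by simp
    then show "a \<odot>\<^bsub>?Q\<^esub> X \<in> carrier ?Q"
      unfolding x(2) carr sm[OF a x(1)] by blast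
    fix b assume b: "b \<in> carrier R"
    show "(a \<oplus>\<^bsub>R\<^esub> b) \<odot>\<^bsub>?Q\<^esub> X = a \<odot>\<^bsub>?Q\<^esub> X \<oplus>\<^bsub>?Q\<^esub> b \<odot>\<^bsub>?Q\<^esub> X"
      unfolding x(2) by (simp add: add sm a b x(1) smult_l_distr)
    show "(a \<otimes>\<^bsub>R\<^esub> b) \<odot>\<^bsub>?Q\<^esub> X = a \<odot>\<^bsub>?Q\<^esub> (b \<odot>\<^bsub>?Q\<^esub> X)"
      unfolding x(2) by (simp add: sm a b x(1) smult_assoc1)
  next
    fix a X Y assume a: "a \<in> carrier R" and "X \<in> carrier ?Q" "Y \<in> carrier ?Q"
    then obtain x y where x: "x \<in> carrier M" "X = N +>\<^bsub>M\<^esub> x"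
      and y: "y \<in> carrier M" "Y = N +>\<^bsub>M\<^esub> y" unfolding carr by blast
    show "a \<odot>\<^bsub>?Q\<^esub> (X \<oplus>\<^bsub>?Q\<^esub> Y) = a \<odot>\<^bsub>?Q\<^esub> X \<oplus>\<^bsub>?Q\<^esub> a \<odot>\<^bsub>?Q\<^esub> Y"
      unfolding x(2) y(2) by (simp add: add sm a x(1) y(1) smult_r_distr)
  next
    fix X assume "X \<in> carrier ?Q"
    then obtain x where x: "x \<in> carrier M" "X = N +>\<^bsub>M\<^esub> x" unfolding carr by blast
    show "\<one>\<^bsub>R\<^esub> \<odot>\<^bsub>?Q\<^esub> X = X"
      unfolding x(2) by (simp add: sm x(1))
  qed (rule R.is_cring)
qed

end

theory Submission
  imports Defs
begin

text \<open>
  Write \<open>a = (N : M)\<close>. The theorem holds because an RPE filtration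
  \<open>N = M\<^sub>0 \<subset> M\<^sub>1 \<subset> \<dots> \<subset> M\<^sub>n = M\<close> passes to annihilators: the ideals \<open>(M\<^sub>i : M)\<close> form an
  RPE filtration of \<open>R\<close> over \<open>a\<close> with the same primes.

  A regular prime extension of \<open>N\<close> is the same thing as a maximal element \<open>\<pp>\<close> of \<open>Ass(M/N)\<close>,
  the extension being \<open>(N : \<pp>)\<close> (\<open>regular_prime_extension_iff\<close>). Taking residuals commutes,
  \<open>((N : \<pp>) : M) = ((N : M) : \<pp>)\<close> (\<open>Ann_residual_submodule\<close>), so the only question is whether
  \<open>Ass(M/N)\<close> and \<open>Ass(R/a)\<close> have the same maximal elements at every step. When all associated
  primes are isolated, these two sets are equal (\<open>Ass_Ann_eq\<close>): since \<open>M\<close> is finitely generated,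
  \<open>R/a\<close> embeds into a finite power of \<open>M/N\<close>, which gives one inclusion; conversely a prime of
  \<open>Ass(M/N)\<close> contains \<open>a\<close>, hence contains a prime of \<open>Ass(R/a)\<close>, and isolation makes the two
  equal. The hypothesis survives each step because \<open>Ass(M/(N : \<pp>)) \<subseteq> Ass(M/N)\<close>.

  The factorization is a definite description, so existence of a filtration and uniqueness of its
  multiset of primes have to be shown as well. When all associated primes are isolated, both have
  short proofs. Existence (\<open>rpe_factors_exist\<close>): each step strictly enlarges \<open>(N : M)\<close>, and ideals of \<open>R\<close> satisfy the maximum condition. Uniqueness
  (\<open>rpe_factors_unique\<close>): two different first steps \<open>\<pp>\<close> and \<open>\<qq>\<close> can be completed to a diamond,
  because \<open>((N : \<pp>) : \<qq>) = ((N : \<qq>) : \<pp>)\<close> and because \<open>\<qq>\<close> remains associated to \<open>M/(N : \<pp>)\<close>.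
\<close>

section \<open>Lists of primes of RPE filtrations\<close>

definition no_embedded_primes ::
    "('a, 'c) ring_scheme \<Rightarrow> ('a, 'b, 'd) module_scheme \<Rightarrow> 'b set \<Rightarrow> bool"
  where "no_embedded_primes R M N \<longleftrightarrow>
    (\<forall>p\<in>Ass R (quotient_module M N). isolated_prime R M N p)"

text \<open>Only the list of primes matters for the factorization; forgetting the submodules of the filtration
  allows induction on that list.\<close>

definition rpe_factors ::
    "('a, 'c) ring_scheme \<Rightarrow> ('a, 'b, 'd) module_scheme \<Rightarrow> 'b set \<Rightarrow> 'a set list \<Rightarrow> bool"
  where "rpe_factors R M N ps \<longleftrightarrow> (\<exists>F. rpe_filtration R M N F ps)"

lemma rpe_factors_Nil: "rpe_factors R M N [] \<longleftrightarrow> N = carrier M"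
  by (auto simp: rpe_factors_def rpe_filtration_def)

lemma rpe_factors_Cons:
  "rpe_factors R M N (p # ps) \<longleftrightarrow>
    (\<exists>K. regular_prime_extension R M p N K \<and> rpe_factors R M K ps)"
proof
  assume "rpe_factors R M N (p # ps)"
  then obtain F where F: "F 0 = N" "F (Suc (length ps)) = carrier M"
    "\<And>i. i < Suc (length ps) \<Longrightarrow> regular_prime_extension R M ((p # ps) ! i) (F i) (F (Suc i))"
    by (auto simp: rpe_factors_def rpe_filtration_def)
  have "rpe_filtration R M (F 1) (\<lambda>i. F (Suc i)) ps"
    unfolding rpe_filtration_def using F(2) F(3)[of "Suc _"] by auto
  then show "\<exists>K. regular_prime_extension R M p N K \<and> rpe_factors R M K ps"
    using F(1) F(3)[of 0] by (auto simp: rpe_factors_def)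
next
  assume "\<exists>K. regular_prime_extension R M p N K \<and> rpe_factors R M K ps"
  then obtain K F where K: "regular_prime_extension R M p N K" and F: "rpe_filtration R M K F ps"
    by (auto simp: rpe_factors_def)
  have "rpe_filtration R M N (case_nat N F) (p # ps)"
    using K F by (auto simp: rpe_filtration_def nth_Cons split: nat.split)
  then show "rpe_factors R M N (p # ps)"
    by (auto simp: rpe_factors_def)
qed

lemma prime_ideal_factorization_eq:
  assumes "rpe_factors R M N ps"
    and "\<And>qs. rpe_factors R M N qs \<Longrightarrow> mset qs = mset ps"
  shows "prime_ideal_factorization R M N = mset ps"
  unfolding prime_ideal_factorization_def
proof (rule the_equality)
  show "\<exists>F ps'. rpe_filtration R M N F ps' \<and> mset ps = mset ps'"
    using assms(1) unfolding rpe_factors_def by blast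
  show "P = mset ps" if "\<exists>F ps. rpe_filtration R M N F ps \<and> P = mset ps" for P
    using that assms(2) unfolding rpe_factors_def by blast
qed

section \<open>Residuals and associated primes\<close>

lemma (in noetherian_ring) exists_maximal_ideal_in:
  assumes "\<S> \<noteq> {}" "\<And>I. I \<in> \<S> \<Longrightarrow> ideal I R"
  shows "\<exists>J\<in>\<S>. \<forall>I\<in>\<S>. J \<subseteq> I \<longrightarrow> I = J"
proof (rule subset_Zorn)
  fix C assume C: "subset.chain \<S> C"
  show "\<exists>U\<in>\<S>. \<forall>I\<in>C. I \<subseteq> U"
  proof (cases "C = {}")
    case True
    then show ?thesis using assms(1) by blast
  next
    case False
    have "subset.chain {I. ideal I R} C"
      using C assms(2) unfolding pred_on.chain_def by auto
    then have "\<Union>C \<in> C" by (rule ideal_chain_is_trivial[OF False])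
    then show ?thesis using C Union_upper[of _ C] unfolding pred_on.chain_def by (metis subsetD)
  qed
qed

locale noetherian_module = noetherian_ring R + module R M
  for R :: "('a, 'c) ring_scheme" (structure) and M :: "('a, 'b, 'd) module_scheme" (structure)
begin

lemma zero_in_submodule:
  assumes "submodule N R M"
  shows "\<zero>\<^bsub>M\<^esub> \<in> N"
  using assms by (metis submodule_def subgroup.one_closed monoid.select_convs(2))

lemma ideal_residual_ideal:
  assumes N: "submodule N R M" and K: "K \<subseteq> carrier M"
  shows "ideal (residual_ideal R M N K) R"
proof (rule idealI[OF ring_axioms])
  note E = submoduleE[OF N]
  have l: "x \<otimes> a \<in> residual_ideal R M N K"
    if "a \<in> residual_ideal R M N K" "x \<in> carrier R" for a x
    using that K E(4) by (auto simp: residual_ideal_def smult_assoc1 subset_iff)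
  then show "a \<in> residual_ideal R M N K \<Longrightarrow> x \<in> carrier R \<Longrightarrow> x \<otimes> a \<in> residual_ideal R M N K" for a x .
  show "a \<in> residual_ideal R M N K \<Longrightarrow> x \<in> carrier R \<Longrightarrow> a \<otimes> x \<in> residual_ideal R M N K" for a x
    using l[of a x] by (auto simp: residual_ideal_def R.m_comm)
  show "subgroup (residual_ideal R M N K) (add_monoid R)"
  proof (rule group.subgroupI[OF abelian_group.a_group[OF ring.is_abelian_group[OF ring_axioms]]])
    have "\<zero> \<in> residual_ideal R M N K"
      using zero_in_submodule[OF N] K by (auto simp: residual_ideal_def subset_iff)
    then show "residual_ideal R M N K \<noteq> {}" by blast
  next
    fix a assume "a \<in> residual_ideal R M N K"
    then have "\<ominus> a \<in> residual_ideal R M N K"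
      using K E(3) by (auto simp: residual_ideal_def smult_l_minus subset_iff)
    then show "inv\<^bsub>add_monoid R\<^esub> a \<in> residual_ideal R M N K"
      by (simp add: a_inv_def)
  qed (use K E(5) in \<open>auto simp: residual_ideal_def smult_l_distr subset_iff\<close>)
qed

lemma submodule_residual_submodule:
  assumes N: "submodule N R M" and I: "I \<subseteq> carrier R"
  shows "submodule (residual_submodule M N I) R M"
proof (rule submoduleI)
  note E = submoduleE[OF N]
  show "\<zero>\<^bsub>M\<^esub> \<in> residual_submodule M N I"
    using I zero_in_submodule[OF N] by (auto simp: residual_submodule_def subset_iff)
  show "a \<odot>\<^bsub>M\<^esub> x \<in> residual_submodule M N I"
    if a: "a \<in> carrier R" and "x \<in> residual_submodule M N I" for a x
  proof -
    have x: "x \<in> carrier M" "\<And>b. b \<in> I \<Longrightarrow> b \<odot>\<^bsub>M\<^esub> x \<in> N"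
      using that by (auto simp: residual_submodule_def)
    have "b \<odot>\<^bsub>M\<^esub> (a \<odot>\<^bsub>M\<^esub> x) = a \<odot>\<^bsub>M\<^esub> (b \<odot>\<^bsub>M\<^esub> x)" if "b \<in> I" for b
      using that I a x(1) by (metis smult_assoc1 R.m_comm subsetD)
    then show ?thesis using x a E(4) by (auto simp: residual_submodule_def)
  qed
qed (use I submoduleE[OF N] in
    \<open>auto simp: residual_submodule_def smult_r_minus smult_r_distr subset_iff\<close>)

lemma subset_residual_submodule:
  assumes "submodule N R M" "I \<subseteq> carrier R"
  shows "N \<subseteq> residual_submodule M N I"
  using submoduleE(1,4)[OF assms(1)] assms(2) by (auto simp: residual_submodule_def subset_iff)

lemma residual_ideal_residual_submodule:
  assumes "p \<subseteq> carrier R" "K \<subseteq> carrier M"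
  shows "residual_ideal R M (residual_submodule M N p) K =
    {a \<in> carrier R. \<forall>b\<in>p. a \<otimes> b \<in> residual_ideal R M N K}"
proof -
  have "b \<odot>\<^bsub>M\<^esub> (a \<odot>\<^bsub>M\<^esub> x) = (a \<otimes> b) \<odot>\<^bsub>M\<^esub> x"
    if "b \<in> p" "a \<in> carrier R" "x \<in> K" for a b x
    using that assms by (metis smult_assoc1 R.m_comm subsetD)
  then show ?thesis
    using assms by (auto simp: residual_ideal_def residual_submodule_def subset_iff)
qed

lemma residual_submodule_commute:
  assumes "p \<subseteq> carrier R" "q \<subseteq> carrier R"
  shows "residual_submodule M (residual_submodule M N p) q =
    residual_submodule M (residual_submodule M N q) p"
proof -
  have "b \<odot>\<^bsub>M\<^esub> (a \<odot>\<^bsub>M\<^esub> x) = a \<odot>\<^bsub>M\<^esub> (b \<odot>\<^bsub>M\<^esub> x)"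
    if "b \<in> p" "a \<in> q" "x \<in> carrier M" for a b x
    using that assms by (metis smult_assoc1 R.m_comm subsetD)
  then show ?thesis
    using assms by (auto simp: residual_submodule_def subset_iff)
qed

lemma Ass_quotient_iff:
  assumes N: "submodule N R M"
  shows "p \<in> Ass R (quotient_module M N) \<longleftrightarrow>
    primeideal p R \<and> (\<exists>x\<in>carrier M. p = residual_ideal R M N {x})"
proof -
  have sg: "subgroup N (add_monoid M)" using N by (simp add: submodule_def)
  have carr: "carrier (quotient_module M N) = (\<lambda>x. N +>\<^bsub>M\<^esub> x) ` carrier M"
    by (auto simp: quotient_module_def A_RCOSETS_def')
  have "{a \<in> carrier R. a \<odot>\<^bsub>quotient_module M N\<^esub> (N +>\<^bsub>M\<^esub> x) = \<zero>\<^bsub>quotient_module M N\<^esub>}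
      = residual_ideal R M N {x}" if x: "x \<in> carrier M" for x
  proof -
    have "N +>\<^bsub>M\<^esub> (a \<odot>\<^bsub>M\<^esub> x) = N \<longleftrightarrow> a \<odot>\<^bsub>M\<^esub> x \<in> N" if "a \<in> carrier R" for a
      using M.a_coset_join1[of N "a \<odot>\<^bsub>M\<^esub> x"] M.a_coset_join2[of "a \<odot>\<^bsub>M\<^esub> x" N] sg that x by auto
    moreover have "\<zero>\<^bsub>quotient_module M N\<^esub> = N" by (simp add: quotient_module_def)
    ultimately have "a \<odot>\<^bsub>quotient_module M N\<^esub> (N +>\<^bsub>M\<^esub> x) = \<zero>\<^bsub>quotient_module M N\<^esub> \<longleftrightarrow> a \<odot>\<^bsub>M\<^esub> x \<in> N"
      if "a \<in> carrier R" for a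
      using that smult_quotient_module[OF module_axioms N that x] by simp
    then show ?thesis
      unfolding residual_ideal_def by blast
  qed
  then show ?thesis unfolding Ass_def carr by auto
qed

text \<open>An annihilator that is maximal among the annihilators of nonzero elements of \<open>M/N\<close> is prime.
  The maximum is taken only over annihilators containing that of \<open>x\<close>, so that it lies above it.\<close>

lemma exists_associated_prime_above:
  assumes N: "submodule N R M" and x: "x \<in> carrier M" "x \<notin> N"
  obtains q where "q \<in> Ass R (quotient_module M N)" "residual_ideal R M N {x} \<subseteq> q"
proof -
  define \<S> where "\<S> = {residual_ideal R M N {y} |y.
    y \<in> carrier M \<and> y \<notin> N \<and> residual_ideal R M N {x} \<subseteq> residual_ideal R M N {y}}"
  have "\<S> \<noteq> {}" using x by (auto simp: \<S>_def)
  moreover have "ideal I R" if "I \<in> \<S>" for I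
    using that ideal_residual_ideal[OF N] by (auto simp: \<S>_def)
  ultimately obtain J where J: "J \<in> \<S>" and max: "\<forall>I\<in>\<S>. J \<subseteq> I \<longrightarrow> I = J"
    using exists_maximal_ideal_in[of \<S>] by blast
  from J obtain y where y: "y \<in> carrier M" "y \<notin> N" "J = residual_ideal R M N {y}"
    and xJ: "residual_ideal R M N {x} \<subseteq> J" by (auto simp: \<S>_def)
  have "primeideal J R"
  proof (rule primeidealI)
    show "ideal J R" using y ideal_residual_ideal[OF N] by simp
    show "cring R" by (rule R.is_cring)
    have "\<one> \<notin> J" using y by (simp add: residual_ideal_def)
    then show "carrier R \<noteq> J" by auto
    fix a b assume ab: "a \<in> carrier R" "b \<in> carrier R" "a \<otimes> b \<in> J"
    show "a \<in> J \<or> b \<in> J"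
    proof (cases "b \<odot>\<^bsub>M\<^esub> y \<in> N")
      case True
      then show ?thesis using ab y by (simp add: residual_ideal_def)
    next
      case False
      have le: "J \<subseteq> residual_ideal R M N {b \<odot>\<^bsub>M\<^esub> y}"
      proof
        fix c assume "c \<in> J"
        then have c: "c \<in> carrier R" "c \<odot>\<^bsub>M\<^esub> y \<in> N" by (auto simp: y residual_ideal_def)
        have "c \<odot>\<^bsub>M\<^esub> (b \<odot>\<^bsub>M\<^esub> y) = b \<odot>\<^bsub>M\<^esub> (c \<odot>\<^bsub>M\<^esub> y)"
          using c ab y by (metis smult_assoc1 R.m_comm)
        then show "c \<in> residual_ideal R M N {b \<odot>\<^bsub>M\<^esub> y}"
          using c ab submoduleE(4)[OF N] by (simp add: residual_ideal_def)
      qed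
      have "residual_ideal R M N {b \<odot>\<^bsub>M\<^esub> y} \<in> \<S>"
        using le xJ ab y(1) False unfolding \<S>_def by blast
      then have "residual_ideal R M N {b \<odot>\<^bsub>M\<^esub> y} = J" using max le by blast
      moreover have "a \<in> residual_ideal R M N {b \<odot>\<^bsub>M\<^esub> y}"
        using ab y by (simp add: residual_ideal_def smult_assoc1)
      ultimately show ?thesis by blast
    qed
  qed
  then show ?thesis using that[of J] y xJ Ass_quotient_iff[OF N] by blast
qed

text \<open>This takes the place of localization at \<open>p\<close>: an annihilator \<open>J = (N : y)\<close> that is maximal among
  those contained in \<open>p\<close> is prime. For \<open>s \<notin> p\<close>, \<open>(N : sy)\<close> still lies in \<open>p\<close>, so it equals \<open>J\<close>,
  which means that elements outside \<open>p\<close> can be cancelled modulo \<open>J\<close>. If \<open>ab \<in> J\<close>, then either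
  \<open>(N : by) = J\<close>, and it contains \<open>a\<close>, or some element outside \<open>p\<close> kills \<open>by\<close>, and cancelling it
  gives \<open>b \<in> J\<close>.\<close>

lemma exists_associated_prime_below:
  assumes N: "submodule N R M" and x: "x \<in> carrier M"
    and p: "primeideal p R" "residual_ideal R M N {x} \<subseteq> p"
  obtains q where "q \<in> Ass R (quotient_module M N)" "q \<subseteq> p"
proof -
  interpret p: primeideal p R by (rule p(1))
  define \<S> where "\<S> = {residual_ideal R M N {y} |y. y \<in> carrier M \<and> residual_ideal R M N {y} \<subseteq> p}"
  have "\<S> \<noteq> {}" using x p(2) by (auto simp: \<S>_def)
  moreover have "ideal I R" if "I \<in> \<S>" for I
    using that ideal_residual_ideal[OF N] by (auto simp: \<S>_def)
  ultimately obtain J where J: "J \<in> \<S>" and max: "\<forall>I\<in>\<S>. J \<subseteq> I \<longrightarrow> I = J"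
    using exists_maximal_ideal_in[of \<S>] by blast
  from J obtain y where y: "y \<in> carrier M" "J = residual_ideal R M N {y}"
    and Jp: "J \<subseteq> p" by (auto simp: \<S>_def)
  have J_ideal: "ideal J R" using y ideal_residual_ideal[OF N] by simp
  have mem: "c \<in> residual_ideal R M N {s \<odot>\<^bsub>M\<^esub> y} \<longleftrightarrow> c \<otimes> s \<in> J"
    if "c \<in> carrier R" "s \<in> carrier R" for c s
    using that y by (simp add: residual_ideal_def smult_assoc1)
  have le: "J \<subseteq> residual_ideal R M N {s \<odot>\<^bsub>M\<^esub> y}" if "s \<in> carrier R" for s
    using that mem ideal.I_r_closed[OF J_ideal] ideal.Icarr[OF J_ideal] by blast
  have sat: "b \<in> J" if b: "b \<in> carrier R" and s: "s \<in> carrier R" "s \<notin> p" and sb: "s \<otimes> b \<in> J" for b s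
  proof -
    have "residual_ideal R M N {s \<odot>\<^bsub>M\<^esub> y} \<subseteq> p"
    proof
      fix c assume c: "c \<in> residual_ideal R M N {s \<odot>\<^bsub>M\<^esub> y}"
      then have cR: "c \<in> carrier R" by (simp add: residual_ideal_def)
      then have "c \<otimes> s \<in> p" using c mem s Jp by blast
      then show "c \<in> p" using p.I_prime cR s by blast
    qed
    then have "residual_ideal R M N {s \<odot>\<^bsub>M\<^esub> y} = J"
      using max le s(1) y(1) unfolding \<S>_def by blast
    moreover have "b \<in> residual_ideal R M N {s \<odot>\<^bsub>M\<^esub> y}"
      using mem b s sb R.m_comm by simp
    ultimately show ?thesis by blast
  qed
  have "primeideal J R"
  proof (rule primeidealI[OF J_ideal R.is_cring])
    show "carrier R \<noteq> J" using Jp p.I_notcarr p.a_subset by blast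
    fix a b assume ab: "a \<in> carrier R" "b \<in> carrier R" "a \<otimes> b \<in> J"
    show "a \<in> J \<or> b \<in> J"
    proof (cases "residual_ideal R M N {b \<odot>\<^bsub>M\<^esub> y} \<subseteq> p")
      case True
      then have "residual_ideal R M N {b \<odot>\<^bsub>M\<^esub> y} = J"
        using max le ab(2) y(1) unfolding \<S>_def by blast
      then show ?thesis using mem ab by blast
    next
      case False
      then obtain s where "s \<in> residual_ideal R M N {b \<odot>\<^bsub>M\<^esub> y}" "s \<notin> p" by blast
      moreover from this have "s \<in> carrier R" by (simp add: residual_ideal_def)
      ultimately show ?thesis using mem sat ab by blast
    qed
  qed
  then show ?thesis using that[of J] y Jp Ass_quotient_iff[OF N] by blast
qed

text \<open>The annihilator of a finite set is the finite intersection of the annihilators of its elements,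
  and a prime that is a finite intersection of ideals is one of them.\<close>

lemma prime_residual_ideal_of_finite:
  assumes N: "submodule N R M" and A: "finite A" "A \<subseteq> carrier M"
    and q: "primeideal q R" "q = residual_ideal R M N A"
  shows "q \<in> Ass R (quotient_module M N)"
proof -
  interpret q: primeideal q R by (rule q(1))
  have "\<exists>x\<in>A. residual_ideal R M N {x} \<subseteq> q"
  proof (rule ccontr)
    assume none: "\<not> ?thesis"
    have "\<exists>s\<in>carrier R. s \<notin> q \<and> s \<in> residual_ideal R M N B" if "finite B" "B \<subseteq> A" for B
      using that
    proof (induction B)
      case empty
      have "\<one> \<notin> q" using q.I_notcarr q.one_imp_carrier by blast
      then show ?case by (intro bexI[of _ \<one>]) (auto simp: residual_ideal_def)
    next
      case (insert x B)
      then obtain s where s: "s \<in> carrier R" "s \<notin> q" "s \<in> residual_ideal R M N B" by auto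
      obtain t where t: "t \<in> residual_ideal R M N {x}" "t \<notin> q" using none insert.prems by blast
      have tR: "t \<in> carrier R" using t by (simp add: residual_ideal_def)
      have I: "ideal (residual_ideal R M N B) R" "ideal (residual_ideal R M N {x}) R"
        using insert.prems A by (auto intro!: ideal_residual_ideal[OF N])
      have "s \<otimes> t \<in> residual_ideal R M N B" using ideal.I_r_closed[OF I(1) s(3) tR] .
      moreover have "s \<otimes> t \<in> residual_ideal R M N {x}" using ideal.I_l_closed[OF I(2) t(1) s(1)] .
      ultimately have "s \<otimes> t \<in> residual_ideal R M N (insert x B)"
        by (simp add: residual_ideal_def)
      moreover have "s \<otimes> t \<notin> q" using q.I_prime s t tR by blast
      ultimately show ?case using s tR by blast
    qed
    from this[OF A(1) order_refl] show False using q(2) by blast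
  qed
  then obtain x where x: "x \<in> A" "residual_ideal R M N {x} \<subseteq> q" by blast
  have "q \<subseteq> residual_ideal R M N {x}" unfolding q(2) residual_ideal_def using x(1) by blast
  then show ?thesis using x A q(1) Ass_quotient_iff[OF N] by blast
qed

text \<open>If \<open>p\<close> is generated by \<open>b\<^sub>1, \<dots>, b\<^sub>k\<close>, then \<open>x \<mapsto> (b\<^sub>1x, \<dots>, b\<^sub>kx)\<close> embeds \<open>M/(N : p)\<close> into
  \<open>(M/N)\<^sup>k\<close>. On annihilators this reads \<open>((N : p) : x) = (N : {b\<^sub>1x, \<dots>, b\<^sub>kx})\<close>.\<close>

lemma Ass_residual_submodule_subset:
  assumes N: "submodule N R M" and p: "ideal p R"
  shows "Ass R (quotient_module M (residual_submodule M N p)) \<subseteq> Ass R (quotient_module M N)"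
proof
  have pR: "p \<subseteq> carrier R" using ideal.Icarr[OF p] by blast
  obtain A where A: "A \<subseteq> carrier R" "finite A" "p = Idl A" using finetely_gen[OF p] by blast
  fix q assume "q \<in> Ass R (quotient_module M (residual_submodule M N p))"
  then obtain x where q: "primeideal q R" and x: "x \<in> carrier M"
    and q_eq: "q = residual_ideal R M (residual_submodule M N p) {x}"
    using Ass_quotient_iff[OF submodule_residual_submodule[OF N pR]] by blast
  have eq: "a \<odot>\<^bsub>M\<^esub> (b \<odot>\<^bsub>M\<^esub> x) \<in> N \<longleftrightarrow> b \<in> residual_ideal R M N {a \<odot>\<^bsub>M\<^esub> x}"
    if "a \<in> carrier R" "b \<in> carrier R" for a b
  proof -
    have "a \<odot>\<^bsub>M\<^esub> (b \<odot>\<^bsub>M\<^esub> x) = b \<odot>\<^bsub>M\<^esub> (a \<odot>\<^bsub>M\<^esub> x)" using that x by (metis smult_assoc1 R.m_comm)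
    then show ?thesis using that by (simp add: residual_ideal_def)
  qed
  \<comment> \<open>For fixed \<open>a\<close>, the \<open>b\<close> with \<open>abx \<in> N\<close> form an ideal, so testing the generators of \<open>p\<close> suffices.\<close>
  have "q = residual_ideal R M N ((\<lambda>b. b \<odot>\<^bsub>M\<^esub> x) ` A)"
  proof (rule Set.set_eqI)
    fix a
    show "a \<in> q \<longleftrightarrow> a \<in> residual_ideal R M N ((\<lambda>b. b \<odot>\<^bsub>M\<^esub> x) ` A)"
    proof (cases "a \<in> carrier R")
      case True
      have I: "ideal (residual_ideal R M N {a \<odot>\<^bsub>M\<^esub> x}) R"
        using ideal_residual_ideal[OF N] True x by simp
      have "a \<in> q \<longleftrightarrow> p \<subseteq> residual_ideal R M N {a \<odot>\<^bsub>M\<^esub> x}"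
        using True x pR by (auto simp: q_eq residual_ideal_def residual_submodule_def)
      also have "\<dots> \<longleftrightarrow> A \<subseteq> residual_ideal R M N {a \<odot>\<^bsub>M\<^esub> x}"
        using genideal_minimal[OF I] genideal_self[OF A(1)] A(3) by blast
      also have "\<dots> \<longleftrightarrow> a \<in> residual_ideal R M N ((\<lambda>b. b \<odot>\<^bsub>M\<^esub> x) ` A)"
        using eq[OF True] A(1) True by (auto simp: residual_ideal_def[of _ _ _ "_ ` _"])
      finally show ?thesis .
    qed (auto simp: q_eq residual_ideal_def)
  qed
  then show "q \<in> Ass R (quotient_module M N)"
    using prime_residual_ideal_of_finite[OF N _ _ q, of "(\<lambda>b. b \<odot>\<^bsub>M\<^esub> x) ` A"] A x by auto
qed

section \<open>Regular prime extensions\<close>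

text \<open>If \<open>ay \<in> N\<close> with \<open>y \<in> (N : p) - N\<close>, then \<open>a\<close> lies in an associated prime above \<open>(N : y)\<close>. As
  \<open>(N : y)\<close> contains \<open>p\<close>, maximality forces that associated prime to be \<open>p\<close>.\<close>

lemma prime_extension_residual_submodule:
  assumes N: "submodule N R M" and p: "maximal_ass_prime R M N p"
  shows "prime_extension R M p N (residual_submodule M N p)"
proof -
  let ?K = "residual_submodule M N p"
  have pA: "p \<in> Ass R (quotient_module M N)" using p by (simp add: maximal_ass_prime_def)
  then obtain x where pp: "primeideal p R" and x: "x \<in> carrier M" and p_eq: "p = residual_ideal R M N {x}"
    using Ass_quotient_iff[OF N] by blast
  have p_mem: "a \<in> p \<longleftrightarrow> a \<in> carrier R \<and> a \<odot>\<^bsub>M\<^esub> x \<in> N" for a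
    using p_eq by (simp add: residual_ideal_def)
  interpret p: primeideal p R by (rule pp)
  have K: "submodule ?K R M" by (rule submodule_residual_submodule[OF N p.a_subset])
  have NK: "N \<subseteq> ?K" by (rule subset_residual_submodule[OF N p.a_subset])
  have xK: "x \<in> ?K" unfolding residual_submodule_def using x p_mem by blast
  have "\<one> \<notin> p" using p.I_notcarr p.one_imp_carrier by blast
  then have xN: "x \<notin> N" using x p_mem[of \<one>] by simp
  have res: "residual_ideal R M N ?K = p"
  proof
    show "residual_ideal R M N ?K \<subseteq> p"
      unfolding residual_ideal_def using xK p_mem by blast
    show "p \<subseteq> residual_ideal R M N ?K"
      unfolding residual_ideal_def residual_submodule_def using p.a_subset by blast
  qed
  have cancel: "a \<in> p" if a: "a \<in> carrier R" and y: "y \<in> ?K" "y \<notin> N" and ay: "a \<odot>\<^bsub>M\<^esub> y \<in> N" for a y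
  proof -
    have yM: "y \<in> carrier M" using y by (simp add: residual_submodule_def)
    obtain q where q: "q \<in> Ass R (quotient_module M N)" "residual_ideal R M N {y} \<subseteq> q"
      using exists_associated_prime_above[OF N yM y(2)] .
    have "p \<subseteq> residual_ideal R M N {y}" using y(1) p.a_subset
      by (auto simp: residual_ideal_def residual_submodule_def)
    then have "q = p" using p q by (auto simp: maximal_ass_prime_def)
    then show ?thesis using q(2) a ay by (auto simp: residual_ideal_def)
  qed
  interpret KM: module R "M\<lparr>carrier := ?K\<rparr>"
    by (rule submodule.submodule_is_module[OF K module_axioms])
  have "submodule N R (M\<lparr>carrier := ?K\<rparr>)"
    using NK submodule.submodule_is_module[OF N module_axioms]
    by (intro KM.module_incl_imp_submodule) auto
  moreover have "residual_ideal R (M\<lparr>carrier := ?K\<rparr>) N ?K = p"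
    using res by (simp add: residual_ideal_def)
  ultimately show ?thesis
    using K NK xK xN cancel by (auto simp: prime_extension_def prime_submodule_def)
qed

lemma regular_prime_extension_iff:
  assumes "submodule N R M"
  shows "regular_prime_extension R M p N K \<longleftrightarrow>
    maximal_ass_prime R M N p \<and> K = residual_submodule M N p"
  using prime_extension_residual_submodule[OF assms] by (auto simp: regular_prime_extension_def)

lemma rpe_factors_Cons_iff:
  assumes "submodule N R M"
  shows "rpe_factors R M N (p # ps) \<longleftrightarrow>
    maximal_ass_prime R M N p \<and> rpe_factors R M (residual_submodule M N p) ps"
  using regular_prime_extension_iff[OF assms] by (auto simp: rpe_factors_Cons)

lemma Ass_carrier: "Ass R (quotient_module M (carrier M)) = {}"
proof (rule ccontr)
  assume "\<not> ?thesis"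
  then obtain p x where p: "primeideal p R" and x: "x \<in> carrier M"
    and "p = residual_ideal R M (carrier M) {x}"
    using Ass_quotient_iff[OF carrier_is_submodule] by blast
  then have "p = carrier R" using smult_closed x by (auto simp: residual_ideal_def)
  then show False using primeideal.I_notcarr[OF p] by simp
qed

lemma maximal_ass_primeD:
  assumes "submodule N R M" "maximal_ass_prime R M N p"
  shows "primeideal p R" "p \<in> Ass R (quotient_module M N)" "ideal p R" "p \<subseteq> carrier R"
proof -
  show "p \<in> Ass R (quotient_module M N)" using assms(2) by (simp add: maximal_ass_prime_def)
  then show p: "primeideal p R" using Ass_quotient_iff[OF assms(1)] by blast
  then show i: "ideal p R" by (rule primeideal.axioms(1))
  show "p \<subseteq> carrier R" using ideal.Icarr[OF i] by blast
qed

lemma no_embedded_primesD: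
  assumes "no_embedded_primes R M N"
    "p \<in> Ass R (quotient_module M N)" "q \<in> Ass R (quotient_module M N)" "q \<subseteq> p"
  shows "q = p"
  using assms by (auto simp: no_embedded_primes_def isolated_prime_def)

lemma no_embedded_primes_maximal:
  assumes "no_embedded_primes R M N"
  shows "maximal_ass_prime R M N p \<longleftrightarrow> p \<in> Ass R (quotient_module M N)"
  using no_embedded_primesD[OF assms] by (auto simp: maximal_ass_prime_def)

lemma no_embedded_primes_residual_submodule:
  assumes "submodule N R M" "no_embedded_primes R M N" "ideal p R"
  shows "no_embedded_primes R M (residual_submodule M N p)"
  using Ass_residual_submodule_subset[OF assms(1,3)] no_embedded_primesD[OF assms(2)]
  by (auto simp: no_embedded_primes_def isolated_prime_def subset_iff)

text \<open>If \<open>q = (N : x)\<close>, then \<open>((N : p) : x) = (q : p)\<close>, and this is \<open>q\<close> because \<open>q\<close> is prime and \<open>p\<close> is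
  not contained in it.\<close>

lemma associated_prime_survives:
  assumes N: "submodule N R M" and p: "p \<subseteq> carrier R"
    and q: "q \<in> Ass R (quotient_module M N)" and "\<not> p \<subseteq> q"
  shows "q \<in> Ass R (quotient_module M (residual_submodule M N p))"
proof -
  obtain x where qp: "primeideal q R" and x: "x \<in> carrier M" and q_eq: "q = residual_ideal R M N {x}"
    using q Ass_quotient_iff[OF N] by blast
  interpret q: primeideal q R by (rule qp)
  obtain s where s: "s \<in> p" "s \<notin> q" using assms(4) by blast
  have "{a \<in> carrier R. \<forall>b\<in>p. a \<otimes> b \<in> q} = q"
  proof
    show "{a \<in> carrier R. \<forall>b\<in>p. a \<otimes> b \<in> q} \<subseteq> q"
    proof
      fix a assume "a \<in> {a \<in> carrier R. \<forall>b\<in>p. a \<otimes> b \<in> q}"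
      then have "a \<in> carrier R" "a \<otimes> s \<in> q" using s by auto
      then show "a \<in> q" using q.I_prime[of a s] s p by auto
    qed
    show "q \<subseteq> {a \<in> carrier R. \<forall>b\<in>p. a \<otimes> b \<in> q}" using p q.I_r_closed by auto
  qed
  then have "q = residual_ideal R M (residual_submodule M N p) {x}"
    using residual_ideal_residual_submodule[OF p, of "{x}" N] x q_eq by simp
  then show ?thesis
    using qp x Ass_quotient_iff[OF submodule_residual_submodule[OF N p]] by blast
qed

end

section \<open>Comparing a module with its annihilator\<close>

locale noetherian_fg_module = noetherian_module R M
  for R :: "('a, 'c) ring_scheme" (structure) and M :: "('a, 'b, 'd) module_scheme" (structure) +
  assumes finitely_generated: "finitely_generated_module R M"

lemma (in noetherian_ring) self_module_fg:
  assumes "cring R"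
  shows "noetherian_fg_module R (self_module R)"
proof -
  interpret S: module R "self_module R" by (rule module_self_module[OF assms])
  have "generated_submodule R (self_module R) {\<one>} = carrier R"
  proof
    have "carrier (self_module R) = carrier R" by (simp add: self_module_def)
    then show "generated_submodule R (self_module R) {\<one>} \<subseteq> carrier R"
      using S.carrier_is_submodule unfolding generated_submodule_def by auto
    show "carrier R \<subseteq> generated_submodule R (self_module R) {\<one>}"
      unfolding generated_submodule_def
      using ideal.one_imp_carrier submodule_self_module_iff[OF assms] by blast
  qed
  then have "finitely_generated_module R (self_module R)"
    unfolding finitely_generated_module_def
    by (intro exI[of _ "{\<one>}"]) (simp add: self_module_def)
  then show ?thesis
    by (intro noetherian_fg_module.intro noetherian_module.intro
        noetherian_fg_module_axioms.intro noetherian_ring_axioms S.module_axioms)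
qed

context noetherian_fg_module
begin

interpretation self: noetherian_fg_module R "self_module R"
  by (rule self_module_fg[OF R.is_cring])

abbreviation Ann :: "'b set \<Rightarrow> 'a set"
  where "Ann N \<equiv> residual_ideal R M N (carrier M)"

lemma submodule_Ann:
  assumes "submodule N R M"
  shows "submodule (Ann N) R (self_module R)"
  using ideal_residual_ideal[OF assms] submodule_self_module_iff[OF R.is_cring] by blast

lemma residual_ideal_generated:
  assumes N: "submodule N R M" and A: "A \<subseteq> carrier M" "generated_submodule R M A = carrier M"
    and a: "a \<in> carrier R"
  shows "(\<forall>x\<in>carrier M. a \<odot>\<^bsub>M\<^esub> x \<in> N) \<longleftrightarrow> (\<forall>x\<in>A. a \<odot>\<^bsub>M\<^esub> x \<in> N)"
proof
  assume *: "\<forall>x\<in>A. a \<odot>\<^bsub>M\<^esub> x \<in> N"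
  have "submodule (residual_submodule M N {a}) R M"
    using submodule_residual_submodule[OF N] a by simp
  moreover have "A \<subseteq> residual_submodule M N {a}"
    using * A by (auto simp: residual_submodule_def)
  ultimately have "generated_submodule R M A \<subseteq> residual_submodule M N {a}"
    by (auto simp: generated_submodule_def)
  then show "\<forall>x\<in>carrier M. a \<odot>\<^bsub>M\<^esub> x \<in> N"
    using A(2) by (auto simp: residual_submodule_def)
qed (use A in blast)

lemma residual_ideal_self_singleton:
  assumes "r \<in> carrier R"
  shows "residual_ideal R (self_module R) I {r} = {a \<in> carrier R. a \<otimes> r \<in> I}"
  by (simp add: residual_ideal_def self_module_def)

text \<open>If \<open>x\<^sub>1, \<dots>, x\<^sub>k\<close> generate \<open>M\<close>, then \<open>r \<mapsto> (rx\<^sub>1, \<dots>, rx\<^sub>k)\<close> embeds \<open>R/Ann(M/N)\<close> into \<open>(M/N)\<^sup>k\<close>.\<close>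

lemma Ass_Ann_subset:
  assumes N: "submodule N R M"
  shows "Ass R (quotient_module (self_module R) (Ann N)) \<subseteq> Ass R (quotient_module M N)"
proof
  fix q assume "q \<in> Ass R (quotient_module (self_module R) (Ann N))"
  then obtain r where q: "primeideal q R" and r: "r \<in> carrier R"
    and q_eq: "q = {a \<in> carrier R. a \<otimes> r \<in> Ann N}"
    using self.Ass_quotient_iff[OF submodule_Ann[OF N]] residual_ideal_self_singleton
    by (auto simp: self_module_def[of R])
  obtain A where A: "finite A" "A \<subseteq> carrier M" "generated_submodule R M A = carrier M"
    using finitely_generated by (auto simp: finitely_generated_module_def)
  have "q = {a \<in> carrier R. \<forall>x\<in>A. (a \<otimes> r) \<odot>\<^bsub>M\<^esub> x \<in> N}"
    using q_eq r residual_ideal_generated[OF N A(2,3)] by (auto simp: residual_ideal_def)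
  also have "\<dots> = residual_ideal R M N ((\<lambda>x. r \<odot>\<^bsub>M\<^esub> x) ` A)"
    using r A(2) by (auto simp: residual_ideal_def smult_assoc1 subset_iff)
  finally show "q \<in> Ass R (quotient_module M N)"
    using prime_residual_ideal_of_finite[OF N _ _ q, of "(\<lambda>x. r \<odot>\<^bsub>M\<^esub> x) ` A"] A r by auto
qed

text \<open>Any \<open>p \<in> Ass(M/N)\<close> contains \<open>Ann(M/N)\<close>, hence some \<open>q \<in> Ass(R/Ann(M/N))\<close>. By the previous lemma
  \<open>q\<close> is associated to \<open>M/N\<close> too, so that \<open>q = p\<close> as \<open>p\<close> is isolated.\<close>

lemma Ass_Ann_eq:
  assumes N: "submodule N R M" and iso: "no_embedded_primes R M N"
  shows "Ass R (quotient_module (self_module R) (Ann N)) = Ass R (quotient_module M N)"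
proof
  show "Ass R (quotient_module M N) \<subseteq> Ass R (quotient_module (self_module R) (Ann N))"
  proof
    fix p assume p: "p \<in> Ass R (quotient_module M N)"
    then obtain x where pp: "primeideal p R" and x: "x \<in> carrier M" "p = residual_ideal R M N {x}"
      using Ass_quotient_iff[OF N] by blast
    \<comment> \<open>\<open>Ann N\<close> is itself the annihilator of an element, the class of \<open>\<one>\<close>.\<close>
    have "residual_ideal R (self_module R) (Ann N) {\<one>} \<subseteq> p"
      using x by (auto simp: residual_ideal_self_singleton residual_ideal_def[of R M])
    moreover have "\<one> \<in> carrier (self_module R)" by (simp add: self_module_def)
    ultimately obtain q where q: "q \<in> Ass R (quotient_module (self_module R) (Ann N))" "q \<subseteq> p"
      using self.exists_associated_prime_below[OF submodule_Ann[OF N] _ pp] by blast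
    then have "q = p" using Ass_Ann_subset[OF N] no_embedded_primesD[OF iso p] by blast
    then show "p \<in> Ass R (quotient_module (self_module R) (Ann N))" using q(1) by simp
  qed
qed (rule Ass_Ann_subset[OF N])

lemma no_embedded_primes_Ann:
  assumes "submodule N R M" "no_embedded_primes R M N"
  shows "no_embedded_primes R (self_module R) (Ann N)"
  using assms(2) by (simp add: no_embedded_primes_def isolated_prime_def Ass_Ann_eq[OF assms])

lemma Ann_residual_submodule:
  assumes "p \<subseteq> carrier R"
  shows "Ann (residual_submodule M N p) = residual_submodule (self_module R) (Ann N) p"
  using assms R.m_comm
  by (subst residual_ideal_residual_submodule[OF assms order_refl])
    (auto simp: residual_submodule_def self_module_def[of R] subset_iff)

text \<open>Since \<open>p\<close> is also associated to \<open>R/Ann(M/N)\<close>, it is the annihilator of the class of some \<open>r\<close>;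
  this \<open>r\<close> lies in \<open>(Ann(M/N) : p)\<close> but not in \<open>Ann(M/N)\<close>.\<close>

lemma Ann_psubset:
  assumes N: "submodule N R M" and iso: "no_embedded_primes R M N"
    and p: "p \<in> Ass R (quotient_module M N)"
  shows "Ann N \<subset> Ann (residual_submodule M N p)"
proof -
  have max: "maximal_ass_prime R M N p" using no_embedded_primes_maximal[OF iso] p by simp
  note pD = maximal_ass_primeD[OF N max]
  have "p \<in> Ass R (quotient_module (self_module R) (Ann N))" using Ass_Ann_eq[OF N iso] p by simp
  then obtain r where r: "r \<in> carrier R" "p = {a \<in> carrier R. a \<otimes> r \<in> Ann N}"
    using self.Ass_quotient_iff[OF submodule_Ann[OF N]] residual_ideal_self_singleton
    by (auto simp: self_module_def[of R])
  have "\<one> \<notin> p" using pD(3) primeideal.I_notcarr[OF pD(1)] ideal.one_imp_carrier by blast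
  then have "r \<notin> Ann N" using r by auto
  moreover have "r \<in> Ann (residual_submodule M N p)"
    unfolding residual_ideal_residual_submodule[OF pD(4) order_refl]
    using r R.m_comm by auto
  moreover have "Ann N \<subseteq> Ann (residual_submodule M N p)"
    using subset_residual_submodule[OF N pD(4)] by (auto simp: residual_ideal_def)
  ultimately show ?thesis by blast
qed

section \<open>Existence and uniqueness of the factorization\<close>

text \<open>Choose a submodule \<open>K\<close> without a filtration for which \<open>Ann(M/K)\<close> is as large as possible. A regular
  prime extension of \<open>K\<close> has no filtration either, but by \<open>Ann_psubset\<close> the annihilator of its
  quotient is strictly larger.\<close>

lemma rpe_factors_exist:
  assumes "submodule N R M" "no_embedded_primes R M N"
  obtains ps where "rpe_factors R M N ps"
proof (rule ccontr)
  assume "\<not> thesis"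
  define \<B> where "\<B> = {K. submodule K R M \<and> no_embedded_primes R M K \<and> (\<forall>ps. \<not> rpe_factors R M K ps)}"
  have "Ann ` \<B> \<noteq> {}" using assms \<open>\<not> thesis\<close> that by (auto simp: \<B>_def)
  moreover have "ideal I R" if "I \<in> Ann ` \<B>" for I
    using that ideal_residual_ideal by (auto simp: \<B>_def)
  ultimately obtain J where "J \<in> Ann ` \<B>" and max: "\<forall>I\<in>Ann ` \<B>. J \<subseteq> I \<longrightarrow> I = J"
    using exists_maximal_ideal_in[of "Ann ` \<B>"] by blast
  then obtain K where K: "submodule K R M" "no_embedded_primes R M K"
    and none: "\<And>ps. \<not> rpe_factors R M K ps" and J: "J = Ann K"
    by (auto simp: \<B>_def)
  have "K \<noteq> carrier M" using none[of "[]"] by (simp add: rpe_factors_Nil)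
  then obtain x where "x \<in> carrier M" "x \<notin> K" using submoduleE(1)[OF K(1)] by blast
  then obtain p where p: "p \<in> Ass R (quotient_module M K)"
    using exists_associated_prime_above[OF K(1)] by blast
  have mp: "maximal_ass_prime R M K p" using no_embedded_primes_maximal[OF K(2)] p by simp
  note pD = maximal_ass_primeD[OF K(1) mp]
  have "residual_submodule M K p \<in> \<B>"
    using submodule_residual_submodule[OF K(1) pD(4)] none[of "p # _"]
      no_embedded_primes_residual_submodule[OF K pD(3)] rpe_factors_Cons_iff[OF K(1)] mp
    by (auto simp: \<B>_def)
  then show False using max Ann_psubset[OF K p] unfolding J by blast
qed

text \<open>Let the two lists begin with different primes \<open>p\<close> and \<open>q\<close>, and let \<open>rs\<close> be a list for
  \<open>L = ((N : p) : q) = ((N : q) : p)\<close>. Then \<open>q # rs\<close> is a list for \<open>(N : p)\<close> and \<open>p # rs\<close> is one for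
  \<open>(N : q)\<close>, and comparing each with the given tail shows that both lists are permutations of
  \<open>p # q # rs\<close>. The induction is on the length of the list and not on its structure, because the second
  comparison is made with \<open>p # rs\<close>, which is not a tail of the given list; the first comparison
  shows that it is short enough.\<close>

lemma rpe_factors_unique:
  assumes "submodule N R M" "no_embedded_primes R M N" "rpe_factors R M N ps" "rpe_factors R M N qs"
  shows "mset ps = mset qs"
  using assms
proof (induction "length ps" arbitrary: N ps qs rule: less_induct)
  case less
  note N = less.prems(1) and iso = less.prems(2)
  show ?case
  proof (cases "N = carrier M")
    case True
    then have "\<not> maximal_ass_prime R M N p" for p
      using Ass_carrier by (simp add: maximal_ass_prime_def)
    then have "\<not> rpe_factors R M N (p # rs)" for p rs
      using rpe_factors_Cons_iff[OF N] by simp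
    then show ?thesis using less.prems(3,4) by (metis list.exhaust)
  next
    case False
    then obtain p ps' q qs' where eqs: "ps = p # ps'" "qs = q # qs'"
      using less.prems(3,4) rpe_factors_Nil by (metis list.exhaust)
    have p: "maximal_ass_prime R M N p" and ps': "rpe_factors R M (residual_submodule M N p) ps'"
      and q: "maximal_ass_prime R M N q" and qs': "rpe_factors R M (residual_submodule M N q) qs'"
      using less.prems(3,4) rpe_factors_Cons_iff[OF N] by (auto simp: eqs)
    note pD = maximal_ass_primeD[OF N p] and qD = maximal_ass_primeD[OF N q]
    note Np = submodule_residual_submodule[OF N pD(4)] no_embedded_primes_residual_submodule[OF N iso pD(3)]
    note Nq = submodule_residual_submodule[OF N qD(4)] no_embedded_primes_residual_submodule[OF N iso qD(3)]
    show ?thesis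
    proof (cases "p = q")
      case True
      then show ?thesis using less.hyps[OF _ Np ps', of qs'] qs' by (simp add: eqs)
    next
      case False
      let ?L = "residual_submodule M (residual_submodule M N p) q"
      have L: "submodule ?L R M" "no_embedded_primes R M ?L"
        using submodule_residual_submodule[OF Np(1) qD(4)]
          no_embedded_primes_residual_submodule[OF Np qD(3)] by auto
      obtain rs where rs: "rpe_factors R M ?L rs" using rpe_factors_exist[OF L] .
      have "\<not> p \<subseteq> q" "\<not> q \<subseteq> p" using no_embedded_primesD[OF iso] pD(2) qD(2) False by metis+
      then have "maximal_ass_prime R M (residual_submodule M N p) q"
        "maximal_ass_prime R M (residual_submodule M N q) p"
        using associated_prime_survives[OF N pD(4) qD(2)] associated_prime_survives[OF N qD(4) pD(2)]
          no_embedded_primes_maximal[OF Np(2)] no_embedded_primes_maximal[OF Nq(2)] by auto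
      then have p_rs: "rpe_factors R M (residual_submodule M N p) (q # rs)"
        and q_rs: "rpe_factors R M (residual_submodule M N q) (p # rs)"
        using rs rpe_factors_Cons_iff[OF Np(1)] rpe_factors_Cons_iff[OF Nq(1)]
          residual_submodule_commute[OF pD(4) qD(4)] by auto
      have 1: "mset ps' = mset (q # rs)" using less.hyps[OF _ Np ps' p_rs] by (simp add: eqs)
      then have "length (p # rs) < length ps" using mset_eq_length[OF 1] by (simp add: eqs)
      then have 2: "mset (p # rs) = mset qs'" using less.hyps[OF _ Nq q_rs qs'] by simp
      show ?thesis using 1 2 by (simp add: eqs)
    qed
  qed
qed

text \<open>The annihilators of the terms of an RPE filtration of \<open>M\<close> form one of \<open>R\<close>, because at each step
  the two sets of associated primes agree and residuals commute.\<close>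

lemma rpe_factors_Ann:
  assumes "submodule N R M" "no_embedded_primes R M N" "rpe_factors R M N ps"
  shows "rpe_factors R (self_module R) (Ann N) ps"
  using assms
proof (induction ps arbitrary: N)
  case Nil
  then have "N = carrier M" by (simp add: rpe_factors_Nil)
  then show ?case by (auto simp: rpe_factors_Nil residual_ideal_def self_module_def)
next
  case (Cons p ps)
  note N = Cons.prems(1,2)
  have p: "maximal_ass_prime R M N p" and ps: "rpe_factors R M (residual_submodule M N p) ps"
    using Cons.prems rpe_factors_Cons_iff by auto
  note pD = maximal_ass_primeD[OF N(1) p]
  have "rpe_factors R (self_module R) (Ann (residual_submodule M N p)) ps"
    using Cons.IH[OF submodule_residual_submodule[OF N(1) pD(4)]
        no_embedded_primes_residual_submodule[OF N pD(3)] ps] .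
  moreover have "maximal_ass_prime R (self_module R) (Ann N) p"
    using p by (simp add: maximal_ass_prime_def Ass_Ann_eq[OF N])
  ultimately show ?case
    by (simp add: self.rpe_factors_Cons_iff[OF submodule_Ann[OF N(1)]] Ann_residual_submodule[OF pD(4)])
qed

lemma prime_ideal_factorization_Ann:
  assumes "submodule N R M" "no_embedded_primes R M N"
  shows "prime_ideal_factorization R (self_module R) (Ann N) = prime_ideal_factorization R M N"
proof -
  obtain ps where ps: "rpe_factors R M N ps" using rpe_factors_exist[OF assms] .
  then have ps': "rpe_factors R (self_module R) (Ann N) ps" by (rule rpe_factors_Ann[OF assms])
  have "prime_ideal_factorization R M N = mset ps"
    by (rule prime_ideal_factorization_eq[OF ps rpe_factors_unique[OF assms _ ps]])
  moreover have "prime_ideal_factorization R (self_module R) (Ann N) = mset ps"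
    by (rule prime_ideal_factorization_eq[OF ps' noetherian_fg_module.rpe_factors_unique[OF self_module_fg[OF R.is_cring]
            submodule_Ann[OF assms(1)] no_embedded_primes_Ann[OF assms] _ ps']])
  ultimately show ?thesis by simp
qed

end

theorem theorem2p7:
  fixes R :: "('a, 'c) ring_scheme" and M :: "('a, 'b, 'd) module_scheme" and N :: "'b set"
  assumes "noetherian_ring R"
    and "module R M"
    and "finitely_generated_module R M"
    and "submodule N R M" and "N \<noteq> carrier M"
    and "\<forall>p\<in>Ass R (quotient_module M N). isolated_prime R M N p"
  shows "prime_ideal_factorization R (self_module R) (residual_ideal R M N (carrier M)) =
    prime_ideal_factorization R M N"
proof -
  interpret noetherian_fg_module R M
    using assms by (intro noetherian_fg_module.intro noetherian_module.intro
        noetherian_fg_module_axioms.intro)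
  show ?thesis
    using assms by (intro prime_ideal_factorization_Ann) (auto simp: no_embedded_primes_def)
qed

end
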